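(* Let $Q_0$ be a quiver which is mutation-equivalent to $X_7$ (so $Q_0$ is, up to isomorphism, one of the two quivers $X_7$ and $X_7'$ described in the context), and let $B_0$ be the corresponding skew-symmetric matrix. Let $u=(a_1,a_2,\dots,a_7)$ be the vector defined as follows: $( * )$ if $Q_0$ is the quiver $X_7$, then the coordinate corresponding to the center vertex is equal to $2$ and all the other coordinates are equal to $1$; if $Q_0$ is not the quiver $X_7$ (so $Q_0$ is $X_7'$), then all coordinates are equal to $1$. Then, for any $Y$-seed $(\mathbf c,B)$ with respect to the initial $Y$-seed $(\mathbf c_0,B_0)$, the coordinate vector of $u$ with respect to the basis $\mathbf c$ is of the same form as in $( * )$, with $Q_0$ replaced by the quiver of $B$: if the quiver of $B$ is $X_7$, the coordinate corresponding to its center is $2$ and the others are $1$; if the quiver of $B$ is $X_7'$, all coordinates are $1$. In particular, the coordinates of $u$ with respect to $\mathbf c$ are positive. Moreover, $u$ is a radical vector for $B_0$, i.e. $B_0u=0$, and any radical vector for $B_0$ is a scalar multiple of $u$.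
   Context: Quivers are finite directed multigraphs without loops and without 2-cycles. A quiver $Q$ with vertices $1,\dots,n$ is identified with the skew-symmetric integer $n\times n$ matrix $B=B^Q$ defined by: $B_{i,j}>0$ if and only if there are $B_{i,j}$ many arrows from $j$ to $i$; $B_{i,j}=0$ if $i$ and $j$ are not joined by an arrow. Notation: $[b]_+=\max(b,0)$. For $k\in\{1,\dots,n\}$, the matrix mutation $\mu_k(B)=B'$ is given by $B'_{ij}=-B_{ij}$ if $i=k$ or $j=k$, and $B'_{ij}=B_{ij}+[B_{ik}]_+[B_{kj}]_+-[-B_{ik}]_+[-B_{kj}]_+$ otherwise. It is an involution; two matrices (or the corresponding quivers) are mutation-equivalent if one is obtained from the other by a finite sequence of mutations (quivers being considered up to isomorphism, i.e. relabeling of vertices). The quiver $X_7$ has vertices $0,a_1,b_1,a_2,b_2,a_3,b_3$ and, for each $i=1,2,3$, one arrow $0\to a_i$, two arrows $a_i\to b_i$, one arrow $b_i\to 0$ (and no other arrows); its center is the vertex $0$. The quiver $X_7'$ has vertices $0,a_1,b_1,a_2,b_2,a_3,b_3$ and the following arrows, each of multiplicity one (and no others): $a_i\to 0$, $0\to b_i$, $a_i\to b_i$ for $i=1,2,3$, and $b_i\to a_j$ for all $i\neq j$ in $\{1,2,3\}$. It is known that the mutation class of $X_7$ consists, up to isomorphism, of $X_7$ and $X_7'$. A $Y$-seed is a pair $(\mathbf c,B)$ with $B$ a skew-symmetric integer $n\times n$ matrix and $\mathbf c=(\mathbf c_1,\dots,\mathbf c_n)$ a tuple of non-zero vectors in $\mathbb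 Z^n$. Write $\mathbf c_j>0$ (resp. $\mathbf c_j<0$) if all entries of the non-zero vector $\mathbf c_j$ are non-negative (resp. non-positive), and $\operatorname{sgn}(\mathbf c_j)=1$ (resp. $-1$) accordingly. If $\mathbf c_k>0$ or $\mathbf c_k<0$, the $Y$-seed mutation $\mu_k(\mathbf c,B)=(\mathbf c',B')$ is defined by $B'=\mu_k(B)$, $\mathbf c'_k=-\mathbf c_k$, and $\mathbf c'_i=\mathbf c_i+[\operatorname{sgn}(\mathbf c_k)B_{k,i}]_+\mathbf c_k$ for $i\ne k$. The initial $Y$-seed is $(\mathbf c_0,B_0)$, where $\mathbf c_0$ is the tuple of standard basis vectors of $\mathbb Z^n$ (here $n=7$). A $Y$-seed with respect to the initial $Y$-seed $(\mathbf c_0,B_0)$ is one obtained from $(\mathbf c_0,B_0)$ by a finite (possibly empty) sequence of $Y$-seed mutations. For skew-symmetric $B_0$ it is known that in every such $Y$-seed every $\mathbf c_j$ satisfies $\mathbf c_j>0$ or $\mathbf c_j<0$, so mutations are always defined, and $\mathbf c$ is a basis of $\mathbb Z^n$; the coordinates of $u$ with respect to $\mathbf c$ are the numbers $x_i$ with $u=\sum_i x_i\mathbf c_i$, the $i$-th coordinate corresponding to vertex $i$ of the quiver of $B$. *)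

theory Defs
  imports "HOL-Analysis.Analysis" "HOL-Library.Numeral_Type"
begin

(* A quiver is given by its arrow multiplicities: arr i j is the number of arrows from i to j.
   Entry (i, j) of its matrix is positive if there are arrows from j to i. *)
definition quiver_matrix :: "('n \<Rightarrow> 'n \<Rightarrow> nat) \<Rightarrow> int^'n^'n" where
  "quiver_matrix arr = (\<chi> i j. int (arr j i) - int (arr i j))"

definition pos_part :: "int \<Rightarrow> int" where
  "pos_part b = max b 0"

definition mutate :: "'n \<Rightarrow> int^'n^'n \<Rightarrow> int^'n^'n" where
  "mutate k B = (\<chi> i j.
     if i = k \<or> j = k then - B $ i $ j
     else B $ i $ j + pos_part (B $ i $ k) * pos_part (B $ k $ j)
                    - pos_part (- B $ i $ k) * pos_part (- B $ k $ j))"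

definition quiver_iso :: "('n \<Rightarrow> 'm) \<Rightarrow> int^'n^'n \<Rightarrow> int^'m^'m \<Rightarrow> bool" where
  "quiver_iso f B B' \<longleftrightarrow> bij f \<and> (\<forall>i j. B' $ f i $ f j = B $ i $ j)"

definition quiver_isomorphic :: "int^'n^'n \<Rightarrow> int^'m^'m \<Rightarrow> bool" where
  "quiver_isomorphic B B' \<longleftrightarrow> (\<exists>f. quiver_iso f B B')"

definition mutation_equivalent :: "int^'n^'n \<Rightarrow> int^'m^'m \<Rightarrow> bool" where
  "mutation_equivalent B B' \<longleftrightarrow> (\<exists>ks. quiver_isomorphic (fold mutate ks B) B')"

datatype x7_vertex = Center | Va 3 | Vb 3

instance x7_vertex :: finite
proof
  have "(UNIV :: x7_vertex set) \<subseteq> insert Center (range Va \<union> range Vb)"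
  proof
    fix x :: x7_vertex
    show "x \<in> insert Center (range Va \<union> range Vb)"
      by (cases x) auto
  qed
  then show "finite (UNIV :: x7_vertex set)"
    by (rule finite_subset) simp
qed

fun X7_arrows :: "x7_vertex \<Rightarrow> x7_vertex \<Rightarrow> nat" where
  "X7_arrows Center (Va i) = 1"
| "X7_arrows (Va i) (Vb j) = (if i = j then 2 else 0)"
| "X7_arrows (Vb i) Center = 1"
| "X7_arrows _ _ = 0"

fun X7'_arrows :: "x7_vertex \<Rightarrow> x7_vertex \<Rightarrow> nat" where
  "X7'_arrows (Va i) Center = 1"
| "X7'_arrows Center (Vb i) = 1"
| "X7'_arrows (Va i) (Vb j) = (if i = j then 1 else 0)"
| "X7'_arrows (Vb i) (Va j) = (if i \<noteq> j then 1 else 0)"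
| "X7'_arrows _ _ = 0"

definition X7 :: "int^x7_vertex^x7_vertex" where
  "X7 = quiver_matrix X7_arrows"

definition X7' :: "int^x7_vertex^x7_vertex" where
  "X7' = quiver_matrix X7'_arrows"

(* k corresponds to the center of X7 under an isomorphism. The choice of isomorphism does not
   matter: Center is the only vertex of X7 incident to six arrows. *)
definition is_X7_center :: "int^'n^'n \<Rightarrow> 'n \<Rightarrow> bool" where
  "is_X7_center B k \<longleftrightarrow> (\<exists>f. quiver_iso f B X7 \<and> f k = Center)"

definition distinguished_vector :: "int^'n^'n \<Rightarrow> int^'n" where
  "distinguished_vector B =
     (if quiver_isomorphic B X7 then (\<chi> i. if is_X7_center B i then 2 else 1)
      else (\<chi> i. 1))"

(* The order on vectors is the componentwise one, so 0 < v means that v is non-zero with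
   non-negative entries (not that all entries are positive), and dually for v < 0. *)
definition vec_sgn :: "int^'n \<Rightarrow> int" where
  "vec_sgn v = (if 0 < v then 1 else if v < 0 then - 1 else 0)"

definition mutate_c :: "'n \<Rightarrow> ('n \<Rightarrow> int^'n) \<Rightarrow> int^'n^'n \<Rightarrow> 'n \<Rightarrow> int^'n" where
  "mutate_c k c B = (\<lambda>i.
     if i = k then - c k
     else c i + pos_part (vec_sgn (c k) * B $ k $ i) *s c k)"

inductive Y_seed :: "int^'n^'n \<Rightarrow> ('n \<Rightarrow> int^'n) \<Rightarrow> int^'n^'n \<Rightarrow> bool" for B0 where
  initial: "Y_seed B0 (\<lambda>i. axis i 1) B0"
| mutation: "Y_seed B0 (mutate_c k c B) (mutate k B)"
    if "Y_seed B0 c B" and "0 < c k \<or> c k < 0"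

(* The ring of coefficients of v is left open: both int and real vectors are used. *)
definition radical_vector :: "int^'n^'n \<Rightarrow> 'a::comm_ring_1^'n \<Rightarrow> bool" where
  "radical_vector B v \<longleftrightarrow> (\<chi> i j. of_int (B $ i $ j)) *v v = 0"

end

theory Submission
  imports Defs
begin

text \<open>
  A \<open>Y\<close>-seed mutation at \<open>k\<close> changes only the \<open>k\<close>-th coordinate of a fixed vector: \<open>x\<^sub>k\<close> becomes
  \<open>\<Sum>\<^sub>j [\<epsilon> B\<^sub>k\<^sub>j]\<^sub>+ x\<^sub>j - x\<^sub>k\<close> with \<open>\<epsilon>\<close> the sign of \<open>c\<^sub>k\<close>. On the vector of the theorem the two choices
  of \<open>\<epsilon>\<close> agree, because that vector is radical, so one only has to compare this rule with the
  mutations of \<open>X\<^sub>7\<close> and \<open>X\<^sub>7'\<close>, vertex by vertex and up to isomorphism. The coordinate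
  change is an involution, which also shows that coordinates with respect to \<open>c\<close> remain unique.
\<close>

section \<open>Invariance under quiver isomorphism\<close>

lemma quiver_iso_refl: "quiver_iso id B B"
  by (simp add: quiver_iso_def)

lemma quiver_iso_trans:
  "quiver_iso f A B \<Longrightarrow> quiver_iso g B C \<Longrightarrow> quiver_iso (g \<circ> f) A C"
  by (auto simp: quiver_iso_def intro: bij_comp)

lemma quiver_iso_inv:
  assumes "quiver_iso f A B" shows "quiver_iso (inv f) B A"
proof -
  have "bij f" using assms by (simp add: quiver_iso_def)
  moreover have "A $ inv f i $ inv f j = B $ i $ j" for i j
    using assms \<open>bij f\<close> by (metis quiver_iso_def bij_inv_eq_iff)
  ultimately show ?thesis by (simp add: quiver_iso_def bij_imp_bij_inv)
qed

lemma quiver_isomorphic_cong: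
  "quiver_iso f A B \<Longrightarrow> quiver_isomorphic A C \<longleftrightarrow> quiver_isomorphic B C"
  unfolding quiver_isomorphic_def by (meson quiver_iso_inv quiver_iso_trans)

lemma is_X7_center_cong:
  assumes "quiver_iso f A B" shows "is_X7_center A i \<longleftrightarrow> is_X7_center B (f i)"
proof -
  have f: "bij f" using assms by (simp add: quiver_iso_def)
  show ?thesis
  proof
    assume "is_X7_center A i"
    then obtain g where g: "quiver_iso g A X7" "g i = Center"
      by (auto simp: is_X7_center_def)
    then have "quiver_iso (g \<circ> inv f) B X7"
      using assms by (blast intro: quiver_iso_inv quiver_iso_trans)
    moreover have "(g \<circ> inv f) (f i) = Center"
      using f g by (simp add: bij_is_inj)
    ultimately show "is_X7_center B (f i)" by (auto simp: is_X7_center_def)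
  next
    assume "is_X7_center B (f i)"
    then obtain g where "quiver_iso g B X7" "g (f i) = Center"
      by (auto simp: is_X7_center_def)
    then show "is_X7_center A i"
      unfolding is_X7_center_def using quiver_iso_trans[OF assms] by (metis comp_apply)
  qed
qed

lemma distinguished_vector_iso:
  assumes "quiver_iso f A B"
  shows "distinguished_vector A $ i = distinguished_vector B $ f i"
  using quiver_isomorphic_cong[OF assms, of X7] is_X7_center_cong[OF assms]
  by (simp add: distinguished_vector_def)

lemma distinguished_vector_pos: "0 < distinguished_vector B $ i"
  by (simp add: distinguished_vector_def)

lemma quiver_iso_mutate:
  assumes "quiver_iso f A B" shows "quiver_iso f (mutate k A) (mutate (f k) B)"
proof -
  have "inj f" using assms by (simp add: quiver_iso_def bij_is_inj)
  then show ?thesis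
    using assms by (auto simp: quiver_iso_def mutate_def inj_eq)
qed

section \<open>Involutivity of mutation and the change of coordinates\<close>

lemma mutate_mutate: "mutate k (mutate k B) = B"
  by (auto simp: mutate_def vec_eq_iff)

lemma fold_mutate_rev: "fold mutate (rev ks) (fold mutate ks B) = B"
  by (induction ks arbitrary: B) (auto simp: mutate_mutate)

text \<open>Omitting \<open>k\<close> from the sum keeps it free of the one coordinate that changes,
  so the map is an involution for every \<open>e\<close> and every matrix.\<close>

definition mutate_coords :: "int \<Rightarrow> 'n \<Rightarrow> int^'n^'n \<Rightarrow> int^'n \<Rightarrow> int^'n" where
  "mutate_coords e k B x = (\<chi> i. if i = k
     then (\<Sum>j\<in>UNIV - {k}. pos_part (e * B $ k $ j) * x $ j) - x $ k else x $ i)"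

lemma mutate_coords_involution: "mutate_coords e k B (mutate_coords e k B x) = x"
  by (auto simp: mutate_coords_def vec_eq_iff)

text \<open>Collect the multiples of \<open>c k\<close>. The formula turns coordinates in the
  mutated tuple into coordinates in the old one; by involutivity it also serves in the other
  direction.\<close>

lemma sum_mutate_c:
  fixes c :: "'n::finite \<Rightarrow> int^'n"
  shows "(\<Sum>i\<in>UNIV. x $ i *s mutate_c k c B i) =
    (\<Sum>i\<in>UNIV. mutate_coords (vec_sgn (c k)) k B x $ i *s c i)"
proof -
  let ?p = "\<lambda>j. pos_part (vec_sgn (c k) * B $ k $ j)"
  have "(\<Sum>i\<in>UNIV. x $ i *s mutate_c k c B i) =
      - (x $ k *s c k) + (\<Sum>i\<in>UNIV - {k}. x $ i *s (c i + ?p i *s c k))"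
    by (simp add: sum.remove[of UNIV k] mutate_c_def vec_eq_iff)
  also have "\<dots> = - (x $ k *s c k) + (\<Sum>i\<in>UNIV - {k}. x $ i *s c i)
      + (\<Sum>i\<in>UNIV - {k}. ?p i * x $ i) *s c k"
    by (simp add: vec_eq_iff sum.distrib sum_distrib_left algebra_simps)
  also have "\<dots> = (\<Sum>i\<in>UNIV. mutate_coords (vec_sgn (c k)) k B x $ i *s c i)"
    by (simp add: sum.remove[of UNIV k] mutate_coords_def vec_eq_iff algebra_simps)
  finally show ?thesis .
qed

text \<open>Both signs are demanded so that the condition concerns the matrix alone, whatever the
  sign of \<open>c k\<close> in a seed.\<close>

definition mutation_compatible :: "int^'n^'n \<Rightarrow> bool" where
  "mutation_compatible B \<longleftrightarrow> (\<forall>k. \<forall>e\<in>{1, - 1}.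
     distinguished_vector (mutate k B) = mutate_coords e k B (distinguished_vector B))"

text \<open>Reduces the check for all quivers of the mutation class to \<open>X7\<close> and
  \<open>X7'\<close>.\<close>

lemma mutation_compatible_iso:
  fixes A :: "int^'n::finite^'n" and B :: "int^'m::finite^'m"
  assumes f: "quiver_iso f A B" and B: "mutation_compatible B"
  shows "mutation_compatible A"
  unfolding mutation_compatible_def
proof (intro allI ballI)
  fix k and e :: int assume e: "e \<in> {1, - 1}"
  have bij: "bij f" and A: "\<And>i j. A $ i $ j = B $ f i $ f j"
    using f by (auto simp: quiver_iso_def)
  have "(\<Sum>j\<in>UNIV - {k}. pos_part (e * A $ k $ j) * distinguished_vector A $ j) =
      (\<Sum>j\<in>UNIV - {f k}. pos_part (e * B $ f k $ j) * distinguished_vector B $ j)"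
  proof (rule sum.reindex_bij_betw[where h = f and
        g = "\<lambda>j. pos_part (e * B $ f k $ j) * distinguished_vector B $ j",
        THEN [2] trans])
    show "bij_betw f (UNIV - {k}) (UNIV - {f k})"
      using bij_betw_DiffI[OF bij] by (simp add: bij_betw_def)
  qed (simp add: A distinguished_vector_iso[OF f])
  then have "mutate_coords e k A (distinguished_vector A) $ i =
      mutate_coords e (f k) B (distinguished_vector B) $ f i" for i
    using bij by (simp add: mutate_coords_def distinguished_vector_iso[OF f] inj_eq bij_is_inj)
  moreover have "distinguished_vector (mutate (f k) B) =
      mutate_coords e (f k) B (distinguished_vector B)"
    using B e unfolding mutation_compatible_def by blast
  ultimately show "distinguished_vector (mutate k A) = mutate_coords e k A (distinguished_vector A)"
    by (simp add: vec_eq_iff distinguished_vector_iso[OF quiver_iso_mutate[OF f]])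
qed

section \<open>The quivers \<open>X7\<close> and \<open>X7'\<close> and their distinguished
  vectors\<close>

lemma UNIV_x7_vertex: "UNIV = insert Center (range Va \<union> range Vb)"
  by (auto intro: x7_vertex.exhaust)

lemma sum_x7_vertex:
  "sum F UNIV = F Center + (\<Sum>i\<in>UNIV. F (Va i)) + (\<Sum>i\<in>UNIV. F (Vb i))"
proof -
  have "sum F UNIV = F Center + sum F (range Va \<union> range Vb)"
    unfolding UNIV_x7_vertex by (subst sum.insert) auto
  also have "sum F (range Va \<union> range Vb) = sum F (range Va) + sum F (range Vb)"
    by (rule sum.union_disjoint) auto
  finally show ?thesis by (simp add: sum.reindex inj_def add.assoc)
qed

lemma forall_x7_vertex: "(\<forall>v. P v) \<longleftrightarrow> P Center \<and> (\<forall>i. P (Va i)) \<and> (\<forall>i. P (Vb i))"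
  by (metis x7_vertex.exhaust)

lemma X7_nth: "X7 $ i $ j = int (X7_arrows j i) - int (X7_arrows i j)"
  by (simp add: X7_def quiver_matrix_def)

lemma X7'_nth: "X7' $ i $ j = int (X7'_arrows j i) - int (X7'_arrows i j)"
  by (simp add: X7'_def quiver_matrix_def)

text \<open>The double arrows of \<open>X\<^sub>7\<close> are used to tell its center from the other
  vertices, and \<open>X\<^sub>7\<close> from \<open>X\<^sub>7'\<close>.\<close>

lemma X7_automorphism_Center:
  assumes "quiver_iso f X7 X7" shows "f v = Center \<longleftrightarrow> v = Center"
proof -
  have double: "v = Center \<longleftrightarrow> (\<forall>w. \<bar>X7 $ v $ w\<bar> \<noteq> 2)" for v
    by (cases v) (auto simp: X7_nth forall_x7_vertex)
  have "(\<forall>w. \<bar>X7 $ f v $ w\<bar> \<noteq> 2) \<longleftrightarrow> (\<forall>w. \<bar>X7 $ f v $ f w\<bar> \<noteq> 2)"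
    using assms by (metis quiver_iso_def bij_pointE)
  then show ?thesis using assms by (simp add: double quiver_iso_def)
qed

lemma X7'_not_isomorphic_X7: "\<not> quiver_isomorphic X7' X7"
proof
  assume "quiver_isomorphic X7' X7"
  then obtain f where f: "quiver_iso f X7' X7" by (auto simp: quiver_isomorphic_def)
  then obtain v w where "f v = Va 1" "f w = Vb 1" by (metis quiver_iso_def bij_pointE)
  then have "X7' $ v $ w = X7 $ Va 1 $ Vb 1" using f by (metis quiver_iso_def)
  then show False
    by (cases v; cases w) (auto simp: X7_nth X7'_nth split: if_splits)
qed

lemma distinguished_vector_X7: "distinguished_vector X7 $ v = (if v = Center then 2 else 1)"
proof -
  have "quiver_isomorphic X7 X7"
    using quiver_iso_refl by (auto simp: quiver_isomorphic_def)
  moreover have "is_X7_center X7 v \<longleftrightarrow> v = Center"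
    using X7_automorphism_Center quiver_iso_refl by (auto simp: is_X7_center_def)
  ultimately show ?thesis by (simp add: distinguished_vector_def)
qed

lemma distinguished_vector_X7': "distinguished_vector X7' $ v = 1"
  by (simp add: distinguished_vector_def X7'_not_isomorphic_X7)

section \<open>Mutations of the two quivers up to isomorphism\<close>

fun X7_swap :: "3 \<Rightarrow> x7_vertex \<Rightarrow> x7_vertex" where
  "X7_swap i Center = Center"
| "X7_swap i (Va j) = (if i = j then Vb j else Va j)"
| "X7_swap i (Vb j) = (if i = j then Va j else Vb j)"

text \<open>Indices live in \<open>\<int>/3\<close>: for \<open>i \<noteq> j\<close> the third index is \<open>- i - j\<close>.\<close>

fun X7'_rot_a :: "3 \<Rightarrow> x7_vertex \<Rightarrow> x7_vertex" where
  "X7'_rot_a i Center = Va i"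
| "X7'_rot_a i (Va j) = Vb (- i - j)"
| "X7'_rot_a i (Vb j) = (if i = j then Center else Va j)"

fun X7'_rot_b :: "3 \<Rightarrow> x7_vertex \<Rightarrow> x7_vertex" where
  "X7'_rot_b i Center = Vb i"
| "X7'_rot_b i (Vb j) = Va (- i - j)"
| "X7'_rot_b i (Va j) = (if i = j then Center else Vb j)"

lemma quiver_isoI:
  fixes f :: "'n::finite \<Rightarrow> 'n"
  assumes "inj f" "\<forall>i j. B $ f i $ f j = A $ i $ j"
  shows "quiver_iso f A B"
  using assms by (simp add: quiver_iso_def bij_def finite_UNIV_inj_surj)

text \<open>Each path from \<open>Vb i\<close> through \<open>Center\<close> to \<open>Va j\<close>
  yields an arrow; for \<open>i = j\<close> it cancels one of the two arrows from
  \<open>Va i\<close> to \<open>Vb i\<close>.\<close>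

lemma mutate_X7_Center: "quiver_iso id (mutate Center X7) X7'"
  by (rule quiver_isoI)
    (simp_all add: mutate_def X7_nth X7'_nth pos_part_def forall_x7_vertex)

text \<open>Either mutation reverses the whole triangle on \<open>Center\<close>,
  \<open>Va i\<close>, \<open>Vb i\<close>: the two composite arrows outnumber the single opposite
  one. Exchanging \<open>Va i\<close> and \<open>Vb i\<close> restores the orientation.\<close>

lemma mutate_X7_swap:
  assumes "k = Va i \<or> k = Vb i"
  shows "quiver_iso (X7_swap i) (mutate k X7) X7"
proof (rule quiver_isoI)
  show "inj (X7_swap i)"
    by (rule inj_on_inverseI[where g = "X7_swap i"]) (case_tac x; simp)
  show "\<forall>v w. X7 $ X7_swap i v $ X7_swap i w = mutate k X7 $ v $ w"
    using assms by (auto simp: mutate_def X7_nth pos_part_def forall_x7_vertex)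
qed

lemma mutate_X7'_Center: "quiver_iso id (mutate Center X7') X7"
  using quiver_iso_mutate[OF quiver_iso_inv[OF mutate_X7_Center], of Center]
  by (simp add: mutate_mutate)

text \<open>After the mutation \<open>Vb i\<close> acts as the center: it receives arrows from
  \<open>Center\<close> and the other two \<open>Vb\<close>, and sends one to each
  \<open>Va\<close>.\<close>

lemma mutate_X7'_Va: "quiver_iso (X7'_rot_a i) (mutate (Va i) X7') X7'"
proof (rule quiver_isoI)
  have "\<forall>v w. X7'_rot_a i v = X7'_rot_a i w \<longrightarrow> v = w"
    using exhaust_3[of i] by (auto simp: forall_x7_vertex forall_3)
  then show "inj (X7'_rot_a i)" by (simp add: inj_def)
  show "\<forall>v w. X7' $ X7'_rot_a i v $ X7'_rot_a i w = mutate (Va i) X7' $ v $ w"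
    using exhaust_3[of i]
    by (elim disjE) (simp_all add: mutate_def X7'_nth pos_part_def forall_x7_vertex forall_3)
qed

text \<open>Here \<open>Va i\<close> becomes the center: it receives an arrow from each
  \<open>Vb\<close>, and sends arrows to \<open>Center\<close> and the other two
  \<open>Va\<close>.\<close>

lemma mutate_X7'_Vb: "quiver_iso (X7'_rot_b i) (mutate (Vb i) X7') X7'"
proof (rule quiver_isoI)
  have "\<forall>v w. X7'_rot_b i v = X7'_rot_b i w \<longrightarrow> v = w"
    using exhaust_3[of i] by (auto simp: forall_x7_vertex forall_3)
  then show "inj (X7'_rot_b i)" by (simp add: inj_def)
  show "\<forall>v w. X7' $ X7'_rot_b i v $ X7'_rot_b i w = mutate (Vb i) X7' $ v $ w"
    using exhaust_3[of i]
    by (elim disjE) (simp_all add: mutate_def X7'_nth pos_part_def forall_x7_vertex forall_3)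
qed

lemma sum_diff_singleton:
  fixes F :: "'a::finite \<Rightarrow> 'b::ab_group_add"
  shows "sum F (UNIV - {k}) = sum F UNIV - F k"
  by (simp add: sum_diff1)

section \<open>Compatibility of the distinguished vectors with mutation\<close>

lemma mutation_compatible_X7: "mutation_compatible X7"
  unfolding mutation_compatible_def
proof (intro allI ballI)
  fix k and e :: int assume e: "e \<in> {1, - 1}"
  show "distinguished_vector (mutate k X7) = mutate_coords e k X7 (distinguished_vector X7)"
  proof (cases "k = Center")
    case True
    \<comment> \<open>Three neighbours of coordinate 1 count for either sign, so the center changes
      from 2 to 3 - 2 = 1.\<close>
    then show ?thesis
      using e by (auto simp: vec_eq_iff distinguished_vector_iso[OF mutate_X7_Center]
          distinguished_vector_X7 distinguished_vector_X7' mutate_coords_def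
          sum_diff_singleton sum_x7_vertex X7_nth pos_part_def)
  next
    case False
    then obtain i where k: "k = Va i \<or> k = Vb i" by (cases k) auto
    have "X7_swap i v = Center \<longleftrightarrow> v = Center" for v by (cases v) auto
    then have "distinguished_vector (mutate k X7) = distinguished_vector X7"
      by (simp add: vec_eq_iff distinguished_vector_iso[OF mutate_X7_swap[OF k]]
          distinguished_vector_X7)
    \<comment> \<open>One sign selects the single arrow joining \<open>k\<close> to the center, of
      coordinate 2; the other selects the double arrow, with neighbour of coordinate 1. So the
      coordinate at \<open>k\<close> stays 2 - 1 = 1.\<close>
    moreover have "(\<Sum>j\<in>UNIV - {k}. pos_part (e * X7 $ k $ j) * distinguished_vector X7 $ j) = 2"
      using e k exhaust_3[of i]
      by (auto simp: distinguished_vector_X7 sum_diff_singleton sum_x7_vertex sum_3 X7_nth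
          pos_part_def)
    ultimately show ?thesis
      using False by (simp add: vec_eq_iff mutate_coords_def distinguished_vector_X7)
  qed
qed

text \<open>The center has three arrows in and three out, so its coordinate becomes 3 - 1 = 2; every
  other vertex has two each way and keeps 2 - 1 = 1.\<close>

lemma mutation_compatible_X7': "mutation_compatible X7'"
  unfolding mutation_compatible_def
proof (intro allI ballI)
  fix k and e :: int assume e: "e \<in> {1, - 1}"
  show "distinguished_vector (mutate k X7') = mutate_coords e k X7' (distinguished_vector X7')"
  proof (cases k)
    case Center
    then show ?thesis
      using e by (auto simp: vec_eq_iff distinguished_vector_iso[OF mutate_X7'_Center]
          distinguished_vector_X7 distinguished_vector_X7' mutate_coords_def
          sum_diff_singleton sum_x7_vertex X7'_nth pos_part_def)
  next
    case (Va i)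
    then show ?thesis
      using e exhaust_3[of i]
      by (auto simp: vec_eq_iff distinguished_vector_iso[OF mutate_X7'_Va]
          distinguished_vector_X7' mutate_coords_def
          sum_diff_singleton sum_x7_vertex sum_3 X7'_nth pos_part_def)
  next
    case (Vb i)
    then show ?thesis
      using e exhaust_3[of i]
      by (auto simp: vec_eq_iff distinguished_vector_iso[OF mutate_X7'_Vb]
          distinguished_vector_X7' mutate_coords_def
          sum_diff_singleton sum_x7_vertex sum_3 X7'_nth pos_part_def)
  qed
qed

section \<open>The mutation class of \<open>X7\<close>\<close>

definition X7_class :: "int^'n^'n \<Rightarrow> bool" where
  "X7_class B \<longleftrightarrow> quiver_isomorphic B X7 \<or> quiver_isomorphic B X7'"

lemma X7_class_mutate:
  fixes B :: "int^'n^'n"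
  assumes "X7_class B" shows "X7_class (mutate k B)"
proof -
  have X7: "X7_class (mutate k X7)" for k
    using mutate_X7_Center mutate_X7_swap
    by (cases k) (auto simp: X7_class_def quiver_isomorphic_def)
  have X7': "X7_class (mutate k X7')" for k
    using mutate_X7'_Center mutate_X7'_Va mutate_X7'_Vb
    by (cases k) (auto simp: X7_class_def quiver_isomorphic_def)
  have "X7_class (mutate k A) \<longleftrightarrow> X7_class (mutate (f k) B)"
    if "quiver_iso f A B" for f and A :: "int^'n^'n" and B :: "int^x7_vertex^x7_vertex" and k
    using quiver_isomorphic_cong[OF quiver_iso_mutate[OF that], of _ X7]
      quiver_isomorphic_cong[OF quiver_iso_mutate[OF that], of _ X7'] by (simp add: X7_class_def)
  then show ?thesis
    using assms X7 X7' unfolding X7_class_def[of B] quiver_isomorphic_def by blast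
qed

lemma X7_class_mutation_equivalent:
  fixes B :: "int^'n^'n"
  assumes "mutation_equivalent B X7" shows "X7_class B"
proof -
  obtain ks where "X7_class (fold mutate ks B)"
    using assms by (auto simp: mutation_equivalent_def X7_class_def)
  moreover have "X7_class A \<Longrightarrow> X7_class (fold mutate ks A)" for ks and A :: "int^'n^'n"
    by (induction ks arbitrary: A) (auto simp: X7_class_mutate)
  \<comment> \<open>The class is closed under mutation, so undoing the sequence \<open>ks\<close> in
    reverse order leads back to \<open>B\<close> inside it.\<close>
  ultimately show ?thesis by (metis fold_mutate_rev)
qed

lemma X7_class_mutation_compatible: "X7_class B \<Longrightarrow> mutation_compatible B"
  using mutation_compatible_X7 mutation_compatible_X7'
  by (auto simp: X7_class_def quiver_isomorphic_def intro: mutation_compatible_iso)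

section \<open>Coordinates in \<open>Y\<close>-seeds\<close>

text \<open>Induction along the mutations: membership in the class provides compatibility at the
  next step, and injectivity of the coordinate map is the uniqueness of coordinates.\<close>

lemma Y_seed_coordinates:
  fixes B0 :: "int^'n::finite^'n"
  assumes "Y_seed B0 c B" and "X7_class B0"
  shows "X7_class B \<and> inj (\<lambda>x. \<Sum>i\<in>UNIV. x $ i *s c i) \<and>
    distinguished_vector B0 = (\<Sum>i\<in>UNIV. distinguished_vector B $ i *s c i)"
  using assms
proof (induction rule: Y_seed.induct)
  case initial
  have "(\<Sum>i\<in>UNIV. x $ i *s axis i 1) = x" for x :: "int^'n"
    by (simp add: basis_expansion)
  then show ?case using initial by (simp add: inj_def)
next
  case (mutation c B k)
  let ?e = "vec_sgn (c k)"
  have X7_class: "X7_class B" and inj: "inj (\<lambda>x. \<Sum>i\<in>UNIV. x $ i *s c i)"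
    and u: "distinguished_vector B0 = (\<Sum>i\<in>UNIV. distinguished_vector B $ i *s c i)"
    using mutation by auto
  \<comment> \<open>The new coordinate map is the old one composed with this involution.\<close>
  have "inj (mutate_coords ?e k B)"
    by (rule inj_on_inverseI) (rule mutate_coords_involution)
  then have "inj (\<lambda>x. \<Sum>i\<in>UNIV. x $ i *s mutate_c k c B i)"
    using inj_compose[OF inj] by (simp add: sum_mutate_c o_def)
  moreover have "?e \<in> {1, - 1}"
    using mutation.hyps(2) by (auto simp: vec_sgn_def)
  then have "distinguished_vector (mutate k B) = mutate_coords ?e k B (distinguished_vector B)"
    using X7_class_mutation_compatible[OF X7_class] unfolding mutation_compatible_def by blast
  then have "distinguished_vector B0 =
      (\<Sum>i\<in>UNIV. distinguished_vector (mutate k B) $ i *s mutate_c k c B i)"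
    by (simp add: sum_mutate_c mutate_coords_involution u)
  ultimately show ?case using X7_class_mutate[OF X7_class] by blast
qed

section \<open>Radical vectors\<close>

lemma radical_vector_nth:
  "radical_vector B v \<longleftrightarrow> (\<forall>i. (\<Sum>j\<in>UNIV. of_int (B $ i $ j) * v $ j) = 0)"
  by (simp add: radical_vector_def matrix_vector_mult_def vec_eq_iff)

text \<open>The class constraint covers integer and real vectors at once; factors 2 may be
  cancelled, but not inverted.\<close>

lemma radical_vector_X7_class:
  fixes v :: "'a::{idom,ring_char_0}^'n::finite"
  assumes "X7_class B"
  shows "radical_vector B v \<longleftrightarrow> (\<exists>t. v = t *s (\<chi> i. of_int (distinguished_vector B $ i)))"
proof -
  have X7: "radical_vector X7 w \<longleftrightarrow> (\<exists>t. \<forall>i. w $ i = t * of_int (distinguished_vector X7 $ i))"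
    for w :: "'a^x7_vertex"
  proof
    assume "radical_vector X7 w"
    \<comment> \<open>The rows of \<open>Va i\<close> and \<open>Vb i\<close>, in this
      order.\<close>
    then have w: "\<And>i. w $ Center = 2 * w $ Vb i" "\<And>i. 2 * w $ Va i = w $ Center"
      by (simp_all add: radical_vector_nth forall_x7_vertex sum_x7_vertex X7_nth
          if_distrib if_distribR cong: if_cong)
    then have "2 * w $ Va i = 2 * w $ Vb 1" "2 * w $ Vb i = 2 * w $ Vb 1" for i
      by metis+
    then have "w $ Va i = w $ Vb 1" "w $ Vb i = w $ Vb 1" for i
      by simp_all
    \<comment> \<open>The multiplier is read off at a vertex of coordinate 1, since half of
      \<open>w $ Center\<close> need not make sense in the ring.\<close>
    then have "\<forall>i. w $ i = w $ Vb 1 * of_int (distinguished_vector X7 $ i)"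
      using w(1)[of 1] by (simp add: forall_x7_vertex distinguished_vector_X7)
    then show "\<exists>t. \<forall>i. w $ i = t * of_int (distinguished_vector X7 $ i)" ..
  next
    assume "\<exists>t. \<forall>i. w $ i = t * of_int (distinguished_vector X7 $ i)"
    then show "radical_vector X7 w"
      by (auto simp: radical_vector_nth forall_x7_vertex forall_3 sum_x7_vertex sum_3 X7_nth
          distinguished_vector_X7)
  qed
  have X7': "radical_vector X7' w \<longleftrightarrow> (\<exists>t. \<forall>i. w $ i = t * of_int (distinguished_vector X7' $ i))"
    for w :: "'a^x7_vertex"
  proof
    assume "radical_vector X7' w"
    \<comment> \<open>The rows of the \<open>Vb\<close> relate the \<open>Va\<close> to the center,
      and the rows of the \<open>Va\<close> relate the \<open>Vb\<close> to it.\<close>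
    then have a: "w $ Center + w $ Va 1 = w $ Va 2 + w $ Va 3"
        "w $ Center + w $ Va 2 = w $ Va 1 + w $ Va 3"
        "w $ Center + w $ Va 3 = w $ Va 1 + w $ Va 2"
      and b: "w $ Center + w $ Vb 1 = w $ Vb 2 + w $ Vb 3"
        "w $ Center + w $ Vb 2 = w $ Vb 1 + w $ Vb 3"
        "w $ Center + w $ Vb 3 = w $ Vb 1 + w $ Vb 2"
      by (simp_all add: radical_vector_nth forall_x7_vertex forall_3 sum_x7_vertex sum_3 X7'_nth
          algebra_simps)
    have const: "x = c \<and> y = c \<and> z = c"
      if "c + x = y + z" "c + y = x + z" "c + z = x + y" for c x y z :: 'a
    proof -
      \<comment> \<open>Differences of the given equations; once \<open>x\<close>, \<open>y\<close>,
        \<open>z\<close> agree, any one of the equations gives \<open>c\<close>.\<close>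
      have "2 * x = 2 * y" "2 * y = 2 * z" using that by algebra+
      then show ?thesis using that by simp
    qed
    have "w $ Va i = w $ Center" "w $ Vb i = w $ Center" for i
      using const[OF a] const[OF b] exhaust_3[of i] by auto
    then have "\<forall>i. w $ i = w $ Center * of_int (distinguished_vector X7' $ i)"
      by (simp add: forall_x7_vertex distinguished_vector_X7')
    then show "\<exists>t. \<forall>i. w $ i = t * of_int (distinguished_vector X7' $ i)" ..
  next
    assume "\<exists>t. \<forall>i. w $ i = t * of_int (distinguished_vector X7' $ i)"
    then show "radical_vector X7' w"
      by (auto simp: radical_vector_nth forall_x7_vertex forall_3 sum_x7_vertex sum_3 X7'_nth
          distinguished_vector_X7')
  qed
  \<comment> \<open>\<open>A\<close> is \<open>X7\<close> or \<open>X7'\<close>; from here both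
    cases are transported along \<open>f\<close> together.\<close>
  obtain A :: "int^x7_vertex^x7_vertex" and f where f: "quiver_iso f B A"
    and A: "\<And>w :: 'a^x7_vertex. radical_vector A w \<longleftrightarrow>
      (\<exists>t. \<forall>i. w $ i = t * of_int (distinguished_vector A $ i))"
    using assms X7 X7' unfolding X7_class_def quiver_isomorphic_def by blast
  have bij: "bij f" and B: "\<And>i j. B $ i $ j = A $ f i $ f j"
    using f by (auto simp: quiver_iso_def)
  define w where "w = (\<chi> i. v $ inv f i)"
  have v: "v $ i = w $ f i" for i using bij by (simp add: w_def bij_is_inj)
  have "radical_vector B v \<longleftrightarrow> radical_vector A w"
  proof -
    have "(\<Sum>j\<in>UNIV. of_int (B $ i $ j) * v $ j) = (\<Sum>j\<in>UNIV. of_int (A $ f i $ j) * w $ j)" for i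
      using sum.reindex_bij_betw[OF bij, of "\<lambda>j. of_int (A $ f i $ j) * w $ j"] by (simp add: B v)
    then show ?thesis using bij by (auto simp: radical_vector_nth) (metis bij_pointE)
  qed
  also have "\<dots> \<longleftrightarrow> (\<exists>t. v = t *s (\<chi> i. of_int (distinguished_vector B $ i)))"
    unfolding A vec_eq_iff using bij
    by (simp add: v distinguished_vector_iso[OF f]) (metis bij_pointE)
  finally show ?thesis .
qed

text \<open>For integer \<open>v\<close> the multiplier is an integer as well, because
  \<open>u\<close> has coordinates equal to 1; the real version describes the kernel over a
  field.\<close>

theorem proposition2:
  fixes B0 :: "int^7^7" and u :: "int^7"
  assumes "mutation_equivalent B0 X7"
    and "u = distinguished_vector B0"
  shows "(\<forall>c B. Y_seed B0 c B \<longrightarrow>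
           (quiver_isomorphic B X7 \<or> quiver_isomorphic B X7') \<and>
           (\<exists>!x :: int^7. u = (\<Sum>i\<in>UNIV. x $ i *s c i)) \<and>
           (\<forall>x :: int^7. u = (\<Sum>i\<in>UNIV. x $ i *s c i) \<longrightarrow>
              x = distinguished_vector B \<and> (\<forall>i. 0 < x $ i))) \<and>
         radical_vector B0 u \<and>
         (\<forall>v :: int^7. radical_vector B0 v \<longrightarrow> (\<exists>t. v = t *s u)) \<and>
         (\<forall>v :: real^7. radical_vector B0 v \<longrightarrow> (\<exists>t. v = t *s (\<chi> i. of_int (u $ i))))"
proof -
  have X7_class: "X7_class B0"
    using assms(1) by (rule X7_class_mutation_equivalent)
  have "X7_class B \<and> (\<exists>!x. u = (\<Sum>i\<in>UNIV. x $ i *s c i)) \<and>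
      (\<forall>x. u = (\<Sum>i\<in>UNIV. x $ i *s c i) \<longrightarrow>
        x = distinguished_vector B \<and> (\<forall>i. 0 < x $ i))" if "Y_seed B0 c B" for c B
  proof -
    have inj: "inj (\<lambda>x. \<Sum>i\<in>UNIV. x $ i *s c i)"
      and u: "u = (\<Sum>i\<in>UNIV. distinguished_vector B $ i *s c i)" and "X7_class B"
      using Y_seed_coordinates[OF that X7_class] assms(2) by auto
    have coords: "x = distinguished_vector B" if "u = (\<Sum>i\<in>UNIV. x $ i *s c i)" for x
      using injD[OF inj, of x "distinguished_vector B"] that u by simp
    have "\<exists>!x. u = (\<Sum>i\<in>UNIV. x $ i *s c i)"
      by (rule ex1I[where a = "distinguished_vector B"]) (rule u, rule coords)
    moreover have "0 < x $ i" if "u = (\<Sum>i\<in>UNIV. x $ i *s c i)" for x i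
      unfolding coords[OF that] by (rule distinguished_vector_pos)
    ultimately show ?thesis using \<open>X7_class B\<close> coords by blast
  qed
  moreover have radical: "radical_vector B0 v \<longleftrightarrow> (\<exists>t. v = t *s u)" for v :: "int^7"
    using radical_vector_X7_class[OF X7_class, of v] by (simp add: assms(2))
  moreover have "radical_vector B0 u"
    unfolding radical by (rule exI[of _ 1]) simp
  moreover have "\<exists>t. v = t *s (\<chi> i. of_int (u $ i))" if "radical_vector B0 v" for v :: "real^7"
    using radical_vector_X7_class[OF X7_class, of v] that by (simp add: assms(2))
  ultimately show ?thesis unfolding X7_class_def by blast
qed

end
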